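(* The approximation ratio of any Disjoint Matching algorithm for Optimisation Polyamorous Scheduling is $\Omega(\log n)$, where $n$ is the number of persons (vertices) of the instance.
   Context: An OPS instance $(P,R,g)$ consists of a finite simple undirected graph $(P,R)$ with growth rates $g:R\to\mathbb R_{>0}$. A schedule $S:\mathbb N_0\to 2^R$ is valid if every $S(t)$ is a matching; its heat is $h(S)=\max_{e\in R} g(e) r_S(e)$, where the recurrence time $r_S(e)$ is the maximal number of days between consecutive occurrences of $e$ (formally, the supremum of $d+1$ over $d\in\mathbb N$ such that $e\notin S(t)\cup\dots\cup S(t+d-1)$ for some $t$, and $1$ if no such $d$ exists). A Disjoint Matching algorithm is an algorithm for OPS whose output schedules use only pairwise disjoint matchings, i.e. each edge belongs to exactly one of the distinct matchings appearing in the schedule (the schedule partitions the edges into disjoint matchings and schedules these matchings as atomic units). The approximation ratio of an algorithm is the supremum over instances of the heat of its output divided by the optimal heat. *)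

theory Defs
  imports
    "HOL-Analysis.Analysis"
    "HOL-Library.Infinite_Typeclass"
    "HOL-Library.Disjoint_Sets"
begin

record 'v ops =
  persons :: "'v set"
  edges :: "'v set set"
  growth :: "'v set \<Rightarrow> real"

text \<open>The growth rates are an extensional function, so that an instance carries no
  information beyond a finite simple graph and a map from its edges to the positive reals.\<close>

definition ops_instance :: "'v ops \<Rightarrow> bool" where
  "ops_instance I \<longleftrightarrow>
     finite (persons I) \<and>
     (\<forall>e\<in>edges I. e \<subseteq> persons I \<and> card e = 2) \<and>
     growth I \<in> edges I \<rightarrow>\<^sub>E {0<..}"

type_synonym 'v schedule = "nat \<Rightarrow> 'v set set"

definition is_matching :: "'v ops \<Rightarrow> 'v set set \<Rightarrow> bool" where
  "is_matching I M \<longleftrightarrow> M \<subseteq> edges I \<and> disjoint M"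

definition valid_schedule :: "'v ops \<Rightarrow> 'v schedule \<Rightarrow> bool" where
  "valid_schedule I S \<longleftrightarrow> (\<forall>t. is_matching I (S t))"

text \<open>The value \<open>d = 0\<close> always qualifies, so the supremum is at least \<open>1\<close>, and it equals
  \<open>1\<close> iff \<open>e\<close> occurs every day. It is \<open>\<infinity>\<close> iff the gaps between occurrences of \<open>e\<close> are
  unbounded, in particular if \<open>e\<close> occurs only finitely often.\<close>

definition recurrence_time :: "'v schedule \<Rightarrow> 'v set \<Rightarrow> ennreal" where
  "recurrence_time S e = (SUP d \<in> {d. \<exists>t. e \<notin> (\<Union>i<d. S (t + i))}. of_nat (d + 1))"

text \<open>The supremum is over a finite set, hence a maximum if there are edges; without edges
  the heat is \<open>0\<close>.\<close>

definition heat :: "'v ops \<Rightarrow> 'v schedule \<Rightarrow> ennreal" where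
  "heat I S = (SUP e \<in> edges I. ennreal (growth I e) * recurrence_time S e)"

definition opt_heat :: "'v ops \<Rightarrow> ennreal" where
  "opt_heat I = (INF S \<in> {S. valid_schedule I S}. heat I S)"

text \<open>A schedule may also contain empty days: the empty matching contains no edge and is
  disjoint from every other matching.\<close>

definition disjoint_matching_schedule :: "'v ops \<Rightarrow> 'v schedule \<Rightarrow> bool" where
  "disjoint_matching_schedule I S \<longleftrightarrow>
     valid_schedule I S \<and> (\<forall>e\<in>edges I. \<exists>!M. M \<in> range S \<and> e \<in> M)"

text \<open>An algorithm is represented by its input-output function, without any restriction on
  computability or running time.\<close>

definition disjoint_matching_algorithm :: "('v ops \<Rightarrow> 'v schedule) \<Rightarrow> bool" where
  "disjoint_matching_algorithm A \<longleftrightarrow>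
     (\<forall>I. ops_instance I \<longrightarrow> disjoint_matching_schedule I (A I))"

text \<open>The approximation ratio as a function of the number \<open>n\<close> of persons. For instances
  without edges the quotient is \<open>0 / 0 = 0\<close>, which does not affect the supremum; for all
  others the optimal heat is positive and finite.\<close>

definition approx_ratio :: "('v ops \<Rightarrow> 'v schedule) \<Rightarrow> nat \<Rightarrow> ennreal" where
  "approx_ratio A n =
     (SUP I \<in> {I. ops_instance I \<and> card (persons I) = n}. heat I (A I) / opt_heat I)"

text \<open>Membership in \<open>\<Omega>(f)\<close> for functions with values in the extended nonnegative reals; the
  library's Landau symbols require values in a normed field, whereas an approximation ratio
  may be infinite.\<close>

definition bigomega_ennreal :: "(nat \<Rightarrow> real) \<Rightarrow> (nat \<Rightarrow> ennreal) set" where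
  "bigomega_ennreal f = {r. \<exists>c>0. \<forall>\<^sub>F n in sequentially. ennreal (c * \<bar>f n\<bar>) \<le> r n}"

end

theory Submission imports Defs begin

text \<open>Take disjoint stars \<open>j = 0, \<dots>, m - 1\<close>, where star \<open>j\<close> has \<open>4 ^ j\<close> edges of growth rate
  \<open>4 ^ -j\<close>. Serving all stars in parallel, each round-robin, has heat \<open>1\<close>. In a partition into
  matchings, the edges of star \<open>j\<close> lie in different matchings, and fewer than half of these
  contain an edge of a smaller star. So star \<open>j\<close> needs more than \<open>4 ^ j / 2\<close> matchings of its
  own, each on a fraction \<open>4 ^ -j / h\<close> of all days if the heat is \<open>h\<close>. Every star thus uses up
  more than a fraction \<open>1 / (2 h)\<close> of the days, which forces \<open>h > m / 2\<close>, while \<open>4 ^ m\<close> persons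
  suffice.\<close>

section \<open>Recurrence times and occurrences of an edge\<close>

lemma recurrence_time_less_imp_occurs:
  assumes "recurrence_time S e < of_nat r"
  shows "\<exists>i<r. e \<in> S (t + i)"
proof (rule ccontr)
  assume "\<not> ?thesis"
  then have "r \<in> {d. \<exists>t. e \<notin> (\<Union>i<d. S (t + i))}"
    by blast
  then have "of_nat (r + 1) \<le> recurrence_time S e"
    unfolding recurrence_time_def by (rule SUP_upper)
  then have "of_nat (r + 1) < (of_nat r :: ennreal)"
    using assms by (rule le_less_trans)
  then show False
    by (simp only: of_nat_less_iff)
qed

lemma recurrence_time_le:
  assumes "\<And>t. \<exists>i<r. e \<in> S (t + i)"
  shows "recurrence_time S e \<le> of_nat r"
  unfolding recurrence_time_def
proof (rule SUP_least)
  fix d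
  assume "d \<in> {d. \<exists>t. e \<notin> (\<Union>i<d. S (t + i))}"
  then obtain t where "\<And>i. i < d \<Longrightarrow> e \<notin> S (t + i)"
    by blast
  with assms[of t] have "d < r"
    by (meson le_less_trans not_le)
  then show "of_nat (d + 1) \<le> (of_nat r :: ennreal)"
    by (simp only: of_nat_le_iff)
qed

text \<open>The first \<open>r * q\<close> days split into \<open>q\<close> blocks of
  \<open>r\<close> days, each with an occurrence.\<close>

lemma card_occurrences_ge:
  assumes "\<And>t. \<exists>i<r. e \<in> S (t + i)"
  shows "q \<le> card {t. t < r * q \<and> e \<in> S t}"
proof (induction q)
  case (Suc q)
  obtain i where i: "i < r" "e \<in> S (r * q + i)"
    using assms by blast
  have "Suc q \<le> card (insert (r * q + i) {t. t < r * q \<and> e \<in> S t})"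
    using Suc.IH by (subst card_insert_disjoint) auto
  also have "\<dots> \<le> card {t. t < r * Suc q \<and> e \<in> S t}"
    using i by (intro card_mono) auto
  finally show ?case .
qed simp

text \<open>The form in which the partition into matchings enters the lower bound.\<close>

lemma disjoint_matching_schedule_same_days:
  assumes "disjoint_matching_schedule I S" "e \<in> edges I" "e \<in> S s" "e \<in> S t"
  shows "S s = S t"
  using assms unfolding disjoint_matching_schedule_def by blast

text \<open>This covers \<open>y = 0\<close>, where \<open>inverse y\<close> is \<top>. Hence an
  upper bound on the optimal heat suffices to pass from heat to ratio.\<close>

lemma le_divide_ennreal:
  fixes x y :: ennreal
  assumes "y \<le> 1"
  shows "x \<le> x / y"
proof -
  have "1 \<le> inverse y"
  proof (cases y)
    case (real r)
    show ?thesis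
    proof (cases "r = 0")
      case False
      then have "1 \<le> inverse r" "inverse y = ennreal (inverse r)"
        using real assms by (simp_all add: one_le_inverse inverse_ennreal)
      then show ?thesis
        by simp
    qed (simp add: real)
  qed (use assms in \<open>simp add: top_unique\<close>)
  then have "x * 1 \<le> x * inverse y"
    by (rule mult_left_mono) simp
  then show ?thesis
    by (simp add: divide_ennreal_def)
qed

section \<open>Instances made of disjoint stars\<close>

lemma exists_inj_nat_prod: "\<exists>v :: nat \<times> nat \<Rightarrow> 'v :: infinite. inj v"
proof -
  obtain f :: "nat \<Rightarrow> 'v" where "inj f"
    using infinite_countable_subset[OF infinite_UNIV] by blast
  then have "inj (f \<circ> prod_encode)"
    by (simp add: inj_compose inj_prod_encode)
  then show ?thesis
    by blast
qed

text \<open>The pair \<open>(j, i)\<close> encodes edge \<open>i\<close> of star \<open>j\<close>,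
  whose centre is \<open>v (j, 0)\<close>. For injective \<open>v\<close>, the \<open>Suc\<close>
  keeps the leaves apart from the centre.\<close>

definition star_edge :: "(nat \<times> nat \<Rightarrow> 'v) \<Rightarrow> nat \<times> nat \<Rightarrow> 'v set" where
  "star_edge v p = {v (fst p, 0), v (fst p, Suc (snd p))}"

definition star_index :: "nat \<Rightarrow> (nat \<times> nat) set" where
  "star_index m = (SIGMA j:{..<m}. {..<4 ^ j})"

text \<open>The set \<open>P\<close> is a parameter so that isolated vertices can pad the stars to a
  prescribed number of persons.\<close>

definition stars_instance :: "(nat \<times> nat \<Rightarrow> 'v) \<Rightarrow> nat \<Rightarrow> 'v set \<Rightarrow> 'v ops" where
  "stars_instance v m P =
     \<lparr>persons = P, edges = star_edge v ` star_index m,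
      growth = (\<lambda>e\<in>star_edge v ` star_index m. 1 / 4 ^ fst (inv (star_edge v) e))\<rparr>"

lemma inj_star_edge: "inj v \<Longrightarrow> inj (star_edge v)"
  by (auto simp: inj_def star_edge_def doubleton_eq_iff)

lemma star_edge_Int_empty_iff:
  "inj v \<Longrightarrow> star_edge v p \<inter> star_edge v q = {} \<longleftrightarrow> fst p \<noteq> fst q"
  by (auto simp: star_edge_def inj_eq)

lemma star_index_iff [simp]: "(j, i) \<in> star_index m \<longleftrightarrow> j < m \<and> i < 4 ^ j"
  by (simp add: star_index_def)

lemma finite_star_index [simp]: "finite (star_index m)"
  by (simp add: star_index_def)

text \<open>A geometric sum. As \<open>star_index j\<close> also indexes the edges of all stars
  smaller than star \<open>j\<close>, these number fewer than half of \<open>4 ^ j\<close>.\<close>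

lemma card_star_index: "3 * card (star_index m) + 1 = 4 ^ m"
  by (induction m) (auto simp: star_index_def)

lemma growth_stars_instance:
  "inj v \<Longrightarrow> p \<in> star_index m \<Longrightarrow> growth (stars_instance v m P) (star_edge v p) = 1 / 4 ^ fst p"
  by (simp add: stars_instance_def inj_star_edge)

text \<open>There are \<open>m\<close> centres and \<open>(4 ^ m - 1) / 3\<close> leaves, at least
  one leaf per centre, hence fewer than \<open>4 ^ m\<close> vertices in the stars. Isolated
  vertices fill up the rest.\<close>

lemma exists_stars_instance:
  fixes v :: "nat \<times> nat \<Rightarrow> 'v :: infinite"
  assumes "inj v" "4 ^ m \<le> n"
  obtains P where "ops_instance (stars_instance v m P)" "card P = n"
proof -
  define V where "V = (\<lambda>j. v (j, 0)) ` {..<m} \<union> (\<lambda>(j, i). v (j, Suc i)) ` star_index m"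
  have fin: "finite V"
    by (simp add: V_def)
  have "m \<le> card (star_index m)"
  proof -
    have "card ((\<lambda>j. (j, 0::nat)) ` {..<m}) \<le> card (star_index m)"
      by (intro card_mono) auto
    then show ?thesis
      by (simp add: card_image inj_on_def)
  qed
  moreover have "card V \<le> m + card (star_index m)"
    unfolding V_def
    by (intro order_trans[OF card_Un_le] add_mono)
      (use card_image_le[of "{..<m}"] card_image_le[OF finite_star_index] in auto)
  ultimately have "card V \<le> n"
    using card_star_index[of m] assms(2) by linarith
  have "infinite (UNIV - V)"
    using fin infinite_UNIV by (simp add: Diff_infinite_finite)
  then obtain W where W: "W \<subseteq> UNIV - V" "finite W" "card W = n - card V"
    using infinite_arbitrarily_large by blast
  have "card (V \<union> W) = n"
    using W fin \<open>card V \<le> n\<close> by (subst card_Un_disjoint) auto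
  moreover have "ops_instance (stars_instance v m (V \<union> W))"
    using W fin assms(1)
    by (fastforce simp: ops_instance_def stars_instance_def star_edge_def V_def inj_eq card_insert_if)
  ultimately show ?thesis
    using that by blast
qed

section \<open>Heat bounds for the star instances\<close>

lemma opt_heat_stars_le:
  assumes "inj v"
  shows "opt_heat (stars_instance v m P) \<le> 1"
proof -
  let ?I = "stars_instance v m P"
  define S where "S t = (\<lambda>j. star_edge v (j, t mod 4 ^ j)) ` {..<m}" for t
  have "valid_schedule ?I S"
    using assms
    by (auto simp: valid_schedule_def is_matching_def S_def stars_instance_def disjoint_def
        star_edge_Int_empty_iff)
  moreover have "heat ?I S \<le> 1"
    unfolding heat_def
  proof (rule SUP_least)
    fix e
    assume "e \<in> edges ?I"
    then obtain j i where e: "e = star_edge v (j, i)" and ji: "j < m" "i < 4 ^ j"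
      by (auto simp: stars_instance_def)
    have "\<exists>d<4 ^ j. e \<in> S (t + d)" for t
    proof -
      have "t mod 4 ^ j < 4 ^ j"
        by simp
      \<comment> \<open>The wait from day \<open>t\<close> until the residue is \<open>i\<close>;
        the summand \<open>4 ^ j\<close> keeps the subtraction from truncating.\<close>
      let ?d = "(i + (4 ^ j - t mod 4 ^ j)) mod 4 ^ j"
      have "(t + ?d) mod 4 ^ j = (t mod 4 ^ j + (i + (4 ^ j - t mod 4 ^ j))) mod 4 ^ j"
        by (simp only: mod_add_left_eq mod_add_right_eq)
      also have "t mod 4 ^ j + (i + (4 ^ j - t mod 4 ^ j)) = i + 4 ^ j"
        using \<open>t mod 4 ^ j < 4 ^ j\<close> by linarith
      finally have "(t + ?d) mod 4 ^ j = i"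
        using ji by simp
      then show ?thesis
        unfolding S_def e
        using ji(1) by (intro exI[of _ ?d] conjI image_eqI[of _ _ j]) (simp_all only: lessThan_iff, simp)
    qed
    then have "recurrence_time S e \<le> of_nat (4 ^ j)"
      by (rule recurrence_time_le)
    then have "ennreal (growth ?I e) * recurrence_time S e \<le> ennreal (1 / 4 ^ j) * of_nat (4 ^ j)"
      using assms ji by (intro mult_mono) (simp_all add: e growth_stars_instance)
    also have "\<dots> = 1"
      by (simp add: ennreal_of_nat_eq_real_of_nat flip: ennreal_mult)
    finally show "ennreal (growth ?I e) * recurrence_time S e \<le> 1" .
  qed
  ultimately show ?thesis
    unfolding opt_heat_def by (blast intro: INF_lower2)
qed

lemma heat_disjoint_matching_stars_ge:
  assumes v: "inj v" and S: "disjoint_matching_schedule (stars_instance v m P) S"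
  shows "of_nat (m div 2) \<le> heat (stars_instance v m P) S"
proof (rule ccontr)
  let ?I = "stars_instance v m P"
  define B where "B = m div 2"
  assume "\<not> ?thesis"
  then have less: "heat ?I S < of_nat B"
    by (simp add: B_def)
  \<comment> \<open>This yields \<open>m > 0\<close>, so the strict comparison of sums at the end is
    over a nonempty range.\<close>
  then have "B > 0"
    by (cases B) auto
  have edges: "edges ?I = star_edge v ` star_index m"
    by (simp add: stars_instance_def)
  \<comment> \<open>The growth rate \<open>1 / 4 ^ j\<close> times a recurrence time of
    \<open>B * 4 ^ j\<close> would already give heat \<open>B\<close>.\<close>
  have occurs: "\<exists>d<B * 4 ^ j. star_edge v (j, i) \<in> S (t + d)" if "(j, i) \<in> star_index m" for j i t
  proof (rule recurrence_time_less_imp_occurs, rule ccontr)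
    let ?e = "star_edge v (j, i)"
    assume "\<not> recurrence_time S ?e < of_nat (B * 4 ^ j)"
    then have "ennreal (1 / 4 ^ j) * of_nat (B * 4 ^ j) \<le> ennreal (growth ?I ?e) * recurrence_time S ?e"
      using that v by (intro mult_mono) (simp_all add: growth_stars_instance)
    also have "\<dots> \<le> heat ?I S"
      unfolding heat_def using that by (intro SUP_upper) (auto simp: edges)
    finally have "ennreal (1 / 4 ^ j) * of_nat (B * 4 ^ j) < of_nat B"
      using less by (rule le_less_trans)
    moreover have "ennreal (1 / 4 ^ j) * of_nat (B * 4 ^ j) = ennreal (1 / 4 ^ j * real (B * 4 ^ j))"
      unfolding ennreal_of_nat_eq_real_of_nat by (rule ennreal_mult[symmetric]) simp_all
    ultimately show False
      by (simp add: ennreal_of_nat_eq_real_of_nat)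
  qed
  \<comment> \<open>The edges in \<open>own j\<close> are those whose matching contains no edge of a
    smaller star.\<close>
  define smaller where
    "smaller j i \<longleftrightarrow> (\<exists>q\<in>star_index j. \<exists>t. star_edge v (j, i) \<in> S t \<and> star_edge v q \<in> S t)" for j i
  define own where "own j = {i. i < 4 ^ j \<and> \<not> smaller j i}" for j
  have same_star: "i = i'" if "star_edge v (j, i) \<in> S t" "star_edge v (j, i') \<in> S t" for i i' j t
  proof -
    have "disjoint (S t)"
      using S by (auto simp: disjoint_matching_schedule_def valid_schedule_def is_matching_def)
    moreover have "star_edge v (j, i) \<inter> star_edge v (j, i') \<noteq> {}"
      by (simp add: star_edge_Int_empty_iff[OF v])
    ultimately have "star_edge v (j, i) = star_edge v (j, i')"
      using that disjointD by blast
    then show ?thesis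
      using inj_star_edge[OF v] by (auto dest: injD)
  qed
  \<comment> \<open>Send each edge outside \<open>own j\<close> to a smaller star's edge in its
    matching. This is injective: a common image would put two edges of star \<open>j\<close> into
    one matching, although they share the centre.\<close>
  have own: "4 ^ j < 2 * card (own j)" if "j < m" for j
  proof -
    let ?C = "{i. i < 4 ^ j \<and> smaller j i}"
    have "\<forall>i\<in>?C. \<exists>q. q \<in> star_index j \<and> (\<exists>t. star_edge v (j, i) \<in> S t \<and> star_edge v q \<in> S t)"
      unfolding smaller_def by blast
    from bchoice[OF this] obtain f where f: "\<And>i. i \<in> ?C \<Longrightarrow> f i \<in> star_index j \<and>
        (\<exists>t. star_edge v (j, i) \<in> S t \<and> star_edge v (f i) \<in> S t)"
      by blast
    have "inj_on f ?C"
    proof (rule inj_onI)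
      fix i i'
      assume i: "i \<in> ?C" "i' \<in> ?C" "f i = f i'"
      obtain s t where st: "star_edge v (j, i) \<in> S s" "star_edge v (f i) \<in> S s"
        "star_edge v (j, i') \<in> S t" "star_edge v (f i) \<in> S t"
        using f[OF i(1)] f[OF i(2)] i(3) by auto
      have "star_edge v (f i) \<in> edges ?I"
        using f[OF i(1)] that by (auto simp: edges star_index_def)
      then have "S s = S t"
        using disjoint_matching_schedule_same_days[OF S] st by blast
      then show "i = i'"
        using same_star st by simp
    qed
    then have "card ?C \<le> card (star_index j)"
      using f by (intro card_inj_on_le[of f]) auto
    moreover have "card ?C + card (own j) = 4 ^ j"
    proof -
      have "card ?C + card (own j) = card (?C \<union> own j)"
        by (intro card_Un_disjoint[symmetric]) (auto simp: own_def)
      also have "?C \<union> own j = {..<4 ^ j}"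
        by (auto simp: own_def)
      finally show ?thesis
        by simp
    qed
    ultimately show ?thesis
      using card_star_index[of j] by linarith
  qed
  \<comment> \<open>This horizon is a multiple of every \<open>B * 4 ^ j\<close> with
    \<open>j < m\<close>, so it splits into whole blocks for each star.\<close>
  define T where "T = B * 4 ^ m"
  define U where "U = (SIGMA j:{..<m}. own j)"
  have fin_own: "finite (own j)" for j
    by (simp add: own_def)
  have U_sub: "U \<subseteq> star_index m"
    by (auto simp: U_def own_def)
  have not_less: "\<not> j < j'"
    if "(j, i) \<in> U" "(j', i') \<in> U" "star_edge v (j, i) \<in> S t" "star_edge v (j', i') \<in> S t"
    for j i j' i' t
  proof
    assume "j < j'"
    then have "(j, i) \<in> star_index j'"
      using that(1) by (simp add: U_def own_def)
    then have "smaller j' i'"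
      unfolding smaller_def using that(3,4) by blast
    then show False
      using that(2) by (simp add: U_def own_def)
  qed
  \<comment> \<open>Hence a day serves at most one edge of \<open>U\<close>, and the total number of
    occurrences of these edges before day \<open>T\<close> is at most \<open>T\<close>.\<close>
  have one: "p = q" if "p \<in> U" "q \<in> U" "star_edge v p \<in> S t" "star_edge v q \<in> S t" for p q t
  proof -
    obtain j i j' i' where pq: "p = (j, i)" "q = (j', i')"
      by (cases p, cases q)
    then have "j = j'"
      using that not_less by (metis linorder_neqE_nat)
    then show ?thesis
      using that same_star pq by blast
  qed
  have "(\<Sum>p\<in>U. card {t. t < T \<and> star_edge v p \<in> S t})
      = card (SIGMA p:U. {t. t < T \<and> star_edge v p \<in> S t})"
    using finite_subset[OF U_sub finite_star_index] by (intro card_SigmaI[symmetric]) auto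
  also have "\<dots> \<le> card {..<T}"
  proof (rule card_inj_on_le[of snd])
    show "inj_on snd (SIGMA p:U. {t. t < T \<and> star_edge v p \<in> S t})"
      using one by (intro inj_onI) (metis (no_types, lifting) SigmaE2 mem_Collect_eq prod.collapse)
  qed auto
  finally have upper: "(\<Sum>p\<in>U. card {t. t < T \<and> star_edge v p \<in> S t}) \<le> T"
    by simp
  have lower: "4 ^ (m - j) \<le> card {t. t < T \<and> star_edge v (j, i) \<in> S t}"
    if "j < m" "i \<in> own j" for i j
  proof -
    have "T = B * 4 ^ j * 4 ^ (m - j)"
      using that by (simp add: T_def flip: power_add)
    then show ?thesis
      using card_occurrences_ge[OF occurs] that by (simp add: own_def)
  qed
  \<comment> \<open>Each star takes up more than \<open>4 ^ m / 2\<close> of the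
    \<open>B * 4 ^ m\<close> days, which is too much for \<open>m\<close> stars as
    \<open>2 * B \<le> m\<close>.\<close>
  have "m * 4 ^ m = (\<Sum>j<m. 4 ^ j * 4 ^ (m - j))"
    by (simp flip: power_add)
  also have "\<dots> < (\<Sum>j<m. 2 * card (own j) * 4 ^ (m - j))"
    using own \<open>B > 0\<close> by (intro sum_strict_mono) (auto simp: B_def lessThan_empty_iff)
  also have "\<dots> = 2 * (\<Sum>j<m. \<Sum>i\<in>own j. 4 ^ (m - j))"
    by (simp add: sum_distrib_left mult.assoc)
  also have "\<dots> \<le> 2 * (\<Sum>j<m. \<Sum>i\<in>own j. card {t. t < T \<and> star_edge v (j, i) \<in> S t})"
    using lower by (intro mult_left_mono sum_mono) auto
  also have "\<dots> = 2 * (\<Sum>p\<in>U. card {t. t < T \<and> star_edge v p \<in> S t})"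
    unfolding U_def using fin_own by (subst sum.Sigma) (auto simp: split_def)
  also have "\<dots> \<le> 2 * B * 4 ^ m"
    using upper by (simp add: T_def)
  also have "\<dots> \<le> m * 4 ^ m"
    by (intro mult_right_mono) (auto simp: B_def)
  finally show False
    by simp
qed

section \<open>From heat to the logarithmic ratio\<close>

lemma approx_ratio_ge:
  fixes A :: "('v :: infinite) ops \<Rightarrow> 'v schedule"
  assumes A: "disjoint_matching_algorithm A" and "4 ^ m \<le> n"
  shows "of_nat (m div 2) \<le> approx_ratio A n"
proof -
  obtain v :: "nat \<times> nat \<Rightarrow> 'v" where v: "inj v"
    using exists_inj_nat_prod by blast
  obtain P where P: "ops_instance (stars_instance v m P)" "card P = n"
    using exists_stars_instance[OF v assms(2)] .
  let ?I = "stars_instance v m P"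
  have "of_nat (m div 2) \<le> heat ?I (A ?I)"
    using heat_disjoint_matching_stars_ge[OF v] A P unfolding disjoint_matching_algorithm_def by blast
  also have "heat ?I (A ?I) \<le> heat ?I (A ?I) / opt_heat ?I"
    using opt_heat_stars_le[OF v] by (rule le_divide_ennreal)
  also have "\<dots> \<le> approx_ratio A n"
    unfolding approx_ratio_def using P by (intro SUP_upper) (simp add: stars_instance_def)
  finally show ?thesis .
qed

theorem theorem4:
  fixes A :: "('v :: infinite) ops \<Rightarrow> 'v schedule"
  assumes "disjoint_matching_algorithm A"
  shows "approx_ratio A \<in> bigomega_ennreal (\<lambda>n. ln (real n))"
proof -
  \<comment> \<open>With \<open>m\<close> the integer part of the base-4 logarithm of
    \<open>n\<close>, \<open>ln n\<close> is at most \<open>(m + 1) * ln 4\<close>, and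
    \<open>ln 4 \<le> 4 - 1\<close>. The factor 12 makes
    \<open>3 * (m + 1) \<le> 12 * (m div 2)\<close> hold from \<open>m = 3\<close> on, with equality
    there.\<close>
  have "ennreal (1 / 12 * \<bar>ln (real n)\<bar>) \<le> approx_ratio A n" if "n \<ge> 4 ^ 3" for n
  proof -
    have "1 \<le> n"
      using that by simp
    then obtain m where m: "4 ^ m \<le> n" "n < 4 ^ (m + 1)"
      using ex_power_ivl1[of 4 n] \<open>1 \<le> n\<close> by auto
    have "(4::nat) ^ 3 < 4 ^ (m + 1)"
      using that m(2) by (rule le_less_trans)
    then have "3 < m + 1"
      by (rule power_less_imp_less_exp[rotated]) simp
    then have "m \<ge> 3"
      by simp
    have "real n < 4 ^ (m + 1)"
      using m(2) by (metis of_nat_less_iff of_nat_numeral of_nat_power)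
    then have "ln (real n) \<le> ln (4 ^ (m + 1))"
      using that by (intro ln_mono) auto
    also have "\<dots> = real (m + 1) * ln 4"
      by (rule ln_realpow)
    also have "\<dots> \<le> real (m + 1) * 3"
      using ln_le_minus_one[of "4::real"] by (intro mult_left_mono) auto
    also have "\<dots> \<le> 12 * real (m div 2)"
    proof -
      have "(m + 1) * 3 \<le> 12 * (m div 2)"
        using \<open>m \<ge> 3\<close> by presburger
      then have "real ((m + 1) * 3) \<le> real (12 * (m div 2))"
        by (simp only: of_nat_le_iff)
      then show ?thesis
        by simp
    qed
    finally have "1 / 12 * \<bar>ln (real n)\<bar> \<le> real (m div 2)"
      using that by simp
    then have "ennreal (1 / 12 * \<bar>ln (real n)\<bar>) \<le> of_nat (m div 2)"
      by (simp add: ennreal_of_nat_eq_real_of_nat ennreal_leI)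
    also have "\<dots> \<le> approx_ratio A n"
      using approx_ratio_ge[OF assms m(1)] .
    finally show ?thesis .
  qed
  then have "\<forall>\<^sub>F n in sequentially. ennreal (1 / 12 * \<bar>ln (real n)\<bar>) \<le> approx_ratio A n"
    by (rule eventually_sequentiallyI)
  then show ?thesis
    unfolding bigomega_ennreal_def by (intro CollectI exI[of _ "1 / 12"]) simp
qed

end
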